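(* Let $(A,\star,\alpha)$ be a hom-associative structure such that $(A,\star)$ is not strongly degenerate and $\alpha:A\to A$ is surjective. Then $\alpha$ is bijective.
   Context: A hom-associative structure $(A,\star,\alpha)$ is a set $A$ together with a binary operation $\star:A\times A\to A$ and a map $\alpha:A\to A$ such that $\alpha(x)\star(y\star z)=(x\star y)\star\alpha(z)$ for all $x,y,z\in A$. No further structure on $A$ and no compatibility of $\alpha$ with $\star$ other than this identity is assumed. $(A,\star)$ is called strongly degenerate if there exist $a\neq b$ in $A$ such that $x\star a=x\star b$ and $a\star x=b\star x$ for all $x\in A$. *)

theory Defs
  imports Main
begin

locale hom_assoc_structure =
  fixes A :: "'a set"
    and star :: "'a \<Rightarrow> 'a \<Rightarrow> 'a"  (infixl "\<star>" 70)
    and \<alpha> :: "'a \<Rightarrow> 'a"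
  assumes star_closed: "x \<in> A \<Longrightarrow> y \<in> A \<Longrightarrow> x \<star> y \<in> A"
    and twist_closed: "x \<in> A \<Longrightarrow> \<alpha> x \<in> A"
    and hom_assoc: "x \<in> A \<Longrightarrow> y \<in> A \<Longrightarrow> z \<in> A \<Longrightarrow> \<alpha> x \<star> (y \<star> z) = (x \<star> y) \<star> \<alpha> z"

definition strongly_degenerate :: "'a set \<Rightarrow> ('a \<Rightarrow> 'a \<Rightarrow> 'a) \<Rightarrow> bool" where
  "strongly_degenerate A star \<longleftrightarrow>
     (\<exists>a\<in>A. \<exists>b\<in>A. a \<noteq> b \<and> (\<forall>x\<in>A. star x a = star x b \<and> star a x = star b x))"

end

theory Submission
  imports Defs
begin

text \<open>
  Suppose \<open>\<alpha> a = \<alpha> b\<close>. Surjectivity lets every element of \<open>A\<close> be written as \<open>\<alpha> x\<close>, so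
  hom-associativity shows that \<open>a\<close> and \<open>b\<close> cannot be told apart by two successive multiplications
  on the same side: \<open>z \<star> (y \<star> a) = z \<star> (y \<star> b)\<close> and \<open>(a \<star> y) \<star> z = (b \<star> y) \<star> z\<close>.

  It remains to descend to a single multiplication. Let \<open>p = x \<star> a\<close> and \<open>q = x \<star> b\<close>. The first
  identity says that \<open>p\<close> and \<open>q\<close> act alike as right factors. As left factors they need not
  visibly agree, so one goes up one step: \<open>p \<star> w\<close> and \<open>q \<star> w\<close> act alike as right factors
  because \<open>p\<close> and \<open>q\<close> do, and they act alike as left factors because twice moving the twist to the
  other side brings \<open>a\<close> and \<open>b\<close> into the position of the second identity. Non-degeneracy,
  applied first to \<open>p \<star> w\<close> and \<open>q \<star> w\<close>, then to \<open>p\<close> and \<open>q\<close>, gives \<open>x \<star> a = x \<star> b\<close>. The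
  opposite operation gives \<open>a \<star> x = b \<star> x\<close>, and a third use of non-degeneracy yields \<open>a = b\<close>.
\<close>

lemma eq_if_not_strongly_degenerate:
  assumes "\<not> strongly_degenerate A star" "a \<in> A" "b \<in> A"
    and "\<And>x. x \<in> A \<Longrightarrow> star x a = star x b"
    and "\<And>x. x \<in> A \<Longrightarrow> star a x = star b x"
  shows "a = b"
  using assms unfolding strongly_degenerate_def by blast

lemma strongly_degenerate_opposite:
  "strongly_degenerate A (\<lambda>x y. star y x) \<longleftrightarrow> strongly_degenerate A star"
  unfolding strongly_degenerate_def by blast

context hom_assoc_structure
begin

text \<open>
  The hom-associative law is its own mirror image, so each statement about right factors also
  gives one about left factors.
\<close>

lemma opposite: "hom_assoc_structure A (\<lambda>x y. y \<star> x) \<alpha>"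
  by unfold_locales (simp_all add: star_closed twist_closed hom_assoc)

text \<open>
  With \<open>z = \<alpha> x\<close>, both sides equal \<open>(x \<star> y) \<star> \<alpha> a\<close>.
\<close>

lemma double_right_factor_eq:
  assumes "\<alpha> ` A = A" and "a \<in> A" "b \<in> A" "\<alpha> a = \<alpha> b" and "y \<in> A" "z \<in> A"
  shows "z \<star> (y \<star> a) = z \<star> (y \<star> b)"
proof -
  obtain x where x: "x \<in> A" "z = \<alpha> x"
    using assms(1,6) by (metis imageE)
  then show ?thesis
    using assms by (simp add: hom_assoc)
qed

lemma double_left_factor_eq:
  assumes "\<alpha> ` A = A" and "a \<in> A" "b \<in> A" "\<alpha> a = \<alpha> b" and "y \<in> A" "z \<in> A"
  shows "(a \<star> y) \<star> z = (b \<star> y) \<star> z"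
  using hom_assoc_structure.double_right_factor_eq[OF opposite assms] .

text \<open>
  Elements with equal right multiplication behaviour pass it on to their right multiples, since
  \<open>\<alpha> t \<star> (p \<star> w) = (t \<star> p) \<star> \<alpha> w\<close> involves \<open>p\<close> only as a right factor of \<open>t\<close>.
\<close>

lemma right_factor_eq_mult:
  assumes "\<alpha> ` A = A" and "p \<in> A" "q \<in> A" and "\<And>t. t \<in> A \<Longrightarrow> t \<star> p = t \<star> q"
    and "w \<in> A" "z \<in> A"
  shows "z \<star> (p \<star> w) = z \<star> (q \<star> w)"
proof -
  obtain t where "t \<in> A" "z = \<alpha> t"
    using assms(1,6) by (metis imageE)
  then show ?thesis
    using assms by (simp add: hom_assoc)
qed

text \<open>
  Twice shifting the twist turns \<open>((x \<star> a) \<star> \<alpha> z) \<star> \<alpha> v\<close> into \<open>\<alpha> (\<alpha> x) \<star> ((a \<star> z) \<star> v)\<close>, where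
  \<open>a\<close> is the left factor in two successive multiplications.
\<close>

lemma inner_factor_eq:
  assumes "\<alpha> ` A = A" and "a \<in> A" "b \<in> A" "\<alpha> a = \<alpha> b" and "x \<in> A" "w \<in> A" "u \<in> A"
  shows "((x \<star> a) \<star> w) \<star> u = ((x \<star> b) \<star> w) \<star> u"
proof -
  obtain z v where zv: "z \<in> A" "w = \<alpha> z" "v \<in> A" "u = \<alpha> v"
    using assms(1,6,7) by (metis imageE)
  have shift: "((x \<star> c) \<star> w) \<star> u = \<alpha> (\<alpha> x) \<star> ((c \<star> z) \<star> v)" if "c \<in> A" for c
  proof -
    have "((x \<star> c) \<star> w) \<star> u = (\<alpha> x \<star> (c \<star> z)) \<star> \<alpha> v"
      using that zv assms by (simp add: hom_assoc)
    also have "\<dots> = \<alpha> (\<alpha> x) \<star> ((c \<star> z) \<star> v)"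
      using that zv assms by (intro hom_assoc[symmetric] star_closed twist_closed)
    finally show ?thesis .
  qed
  then show ?thesis
    using double_left_factor_eq[of a b z v] zv assms by simp
qed

lemma right_factor_eq:
  assumes nd: "\<not> strongly_degenerate A star" and surj: "\<alpha> ` A = A"
    and ab: "a \<in> A" "b \<in> A" "\<alpha> a = \<alpha> b" and x: "x \<in> A"
  shows "x \<star> a = x \<star> b"
proof (rule eq_if_not_strongly_degenerate[OF nd])
  show closed: "x \<star> a \<in> A" "x \<star> b \<in> A"
    using ab x by (auto intro: star_closed)
  show right: "t \<star> (x \<star> a) = t \<star> (x \<star> b)" if "t \<in> A" for t
    using double_right_factor_eq[OF surj ab x that] .
  show "(x \<star> a) \<star> w = (x \<star> b) \<star> w" if w: "w \<in> A" for w
  proof (rule eq_if_not_strongly_degenerate[OF nd])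
    show "(x \<star> a) \<star> w \<in> A" "(x \<star> b) \<star> w \<in> A"
      using closed w by (auto intro: star_closed)
    show "z \<star> ((x \<star> a) \<star> w) = z \<star> ((x \<star> b) \<star> w)" if "z \<in> A" for z
      using right_factor_eq_mult[OF surj closed right w that] .
    show "((x \<star> a) \<star> w) \<star> u = ((x \<star> b) \<star> w) \<star> u" if "u \<in> A" for u
      using inner_factor_eq[OF surj ab x w that] .
  qed
qed

lemma left_factor_eq:
  assumes "\<not> strongly_degenerate A star" and "\<alpha> ` A = A"
    and "a \<in> A" "b \<in> A" "\<alpha> a = \<alpha> b" and "x \<in> A"
  shows "a \<star> x = b \<star> x"
proof -
  have "\<not> strongly_degenerate A (\<lambda>x y. y \<star> x)"
    using assms(1) by (rule contrapos_nn) (rule iffD1[OF strongly_degenerate_opposite])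
  from hom_assoc_structure.right_factor_eq[OF opposite this assms(2-)] show ?thesis .
qed

end

theorem proposition2:
  fixes A :: "'a set" and star :: "'a \<Rightarrow> 'a \<Rightarrow> 'a" and \<alpha> :: "'a \<Rightarrow> 'a"
  assumes "hom_assoc_structure A star \<alpha>"
    and "\<not> strongly_degenerate A star"
    and "\<alpha> ` A = A"
  shows "bij_betw \<alpha> A A"
proof -
  interpret hom_assoc_structure A star \<alpha> by fact
  have "inj_on \<alpha> A"
  proof (rule inj_onI)
    fix a b assume ab: "a \<in> A" "b \<in> A" "\<alpha> a = \<alpha> b"
    show "a = b"
      by (rule eq_if_not_strongly_degenerate[OF assms(2) ab(1,2)
            right_factor_eq[OF assms(2,3) ab] left_factor_eq[OF assms(2,3) ab]])
  qed
  with assms(3) show ?thesis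
    by (simp add: bij_betw_def)
qed

end
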